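(* If $G$ is a connected graph of order $n$, then $\iota_{\rm g}(G)\le \frac{1}{2}n$, with equality if and only if $G\in\{K_2, C_6\}$.
   Context: For a graph $G$ and $X\subseteq V(G)$, $N_G[X]$ denotes the set of vertices in $X$ or adjacent to a vertex of $X$. The isolation game on a finite graph $G$ is played by two players, Dominator and Staller, who alternately select vertices of $G$. If $X$ is the set of vertices selected so far, a vertex $x$ may be selected (is playable) only if $x$ dominates (i.e., equals or is adjacent to) some vertex belonging to a component of $G - N_G[X]$ with at least two vertices. The game ends when no playable vertex exists. Dominator aims to minimize the total number of selected vertices, Staller aims to maximize it. The game isolation number $\iota_{\rm g}(G)$ is the number of vertices selected when Dominator makes the first move and both play optimally. $C_6$ is the cycle on six vertices. *)

theory Defs
  imports "Graph_Theory.Graph_Theory"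
begin

text \<open>
  A finite simple graph is a digraph satisfying the locale predicate \<^const>\<open>graph\<close>:
  each edge is represented by a pair of opposite arcs.
\<close>

definition closed_nbhd :: "('a, 'b) pre_digraph \<Rightarrow> 'a set \<Rightarrow> 'a set" where
  "closed_nbhd G X = X \<union> {v \<in> verts G. \<exists>x \<in> X. x \<rightarrow>\<^bsub>G\<^esub> v}"

text \<open>
  The components of a graph are its strongly connected components, since reachability in a
  symmetric digraph is a symmetric relation.
\<close>

definition playable :: "('a, 'b) pre_digraph \<Rightarrow> 'a set \<Rightarrow> 'a set" where
  "playable G X = {x \<in> verts G. \<exists>C \<in> pre_digraph.sccs (G \<restriction> (verts G - closed_nbhd G X)).
     2 \<le> card (verts C) \<and> (\<exists>y \<in> verts C. x = y \<or> x \<rightarrow>\<^bsub>G\<^esub> y)}"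

lemma playable_subset: "playable G X \<subseteq> verts G - X"
proof
  fix x assume "x \<in> playable G X"
  then obtain C y where x: "x \<in> verts G"
    and C: "C \<in> pre_digraph.sccs (G \<restriction> (verts G - closed_nbhd G X))"
    and y: "y \<in> verts C" "x = y \<or> x \<rightarrow>\<^bsub>G\<^esub> y"
    by (auto simp: playable_def)
  have "verts C \<subseteq> verts G - closed_nbhd G X"
    using C by (auto simp: pre_digraph.sccs_def induced_subgraph_def subgraph_def)
  with x y show "x \<in> verts G - X"
    by (auto simp: closed_nbhd_def)
qed

datatype player = Dominator | Staller

text \<open>
  \<open>moves_left G p X\<close> is the number of vertices still to be selected under optimal play when the
  vertices in \<open>X\<close> have been selected and \<open>p\<close> is to move. The finiteness guard serves only to make
  the recursion terminate on arbitrary digraphs.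
\<close>

function moves_left :: "('a, 'b) pre_digraph \<Rightarrow> player \<Rightarrow> 'a set \<Rightarrow> nat" where
  "moves_left G p X =
    (if \<not> finite (verts G) \<or> playable G X = {} then 0
     else case p of
       Dominator \<Rightarrow> 1 + Min ((\<lambda>x. moves_left G Staller (insert x X)) ` playable G X)
     | Staller \<Rightarrow> 1 + Max ((\<lambda>x. moves_left G Dominator (insert x X)) ` playable G X))"
  by pat_completeness auto
termination
proof (relation "measure (\<lambda>(G, p, X). card (verts G - X))", goal_cases)
  case 1
  show ?case by simp
next
  case (2 G p X x)
  then have "finite (verts G)" "x \<in> verts G - X"
    using subsetD[OF playable_subset, of x G X] by auto
  then have "card (verts G - insert x X) < card (verts G - X)"
    by (intro psubset_card_mono) auto
  then show ?case by simp
next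
  case (3 G p X x)
  then have "finite (verts G)" "x \<in> verts G - X"
    using subsetD[OF playable_subset, of x G X] by auto
  then have "card (verts G - insert x X) < card (verts G - X)"
    by (intro psubset_card_mono) auto
  then show ?case by simp
qed

declare moves_left.simps [simp del]

definition game_isolation_number :: "('a, 'b) pre_digraph \<Rightarrow> nat" (\<open>\<iota>\<^sub>g\<close>) where
  "game_isolation_number G = moves_left G Dominator {}"

text \<open>The cycle on \<open>n\<close> vertices, for \<open>n \<ge> 3\<close>.\<close>

definition cycle_graph :: "nat \<Rightarrow> nat pair_pre_digraph" where
  "cycle_graph n = \<lparr> pverts = {0..<n},
     parcs = {(i, j). i < n \<and> j < n \<and> (j = (i + 1) mod n \<or> i = (j + 1) mod n)} \<rparr>"

end

theory Submission
  imports Defs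
begin

text \<open>
  Call an undominated vertex live if it has an undominated neighbour. If some component of the
  live graph has a vertex of degree at least two, Dominator kills at least three live vertices by
  selecting it and Staller's reply kills at least one more; otherwise all components are single
  edges and every move kills at least two. So two moves account for four vertices, which gives
  the bound. Strictness follows as soon as Dominator can kill four vertices with one move: at the
  start this happens if there is a vertex of degree at least three or a leaf (when the order is at
  least four), or in the 4-cycle. On a cycle of even order at least eight Dominator starts
  anywhere, and a reply killing only one live vertex leaves a path on which four can be killed.
\<close>

section \<open>Neighbourhoods, live vertices and playability\<close>

definition nbhd :: "('a, 'b) pre_digraph \<Rightarrow> 'a \<Rightarrow> 'a set" where
  "nbhd G x = {y. x \<rightarrow>\<^bsub>G\<^esub> y}"

definition live :: "('a, 'b) pre_digraph \<Rightarrow> 'a set \<Rightarrow> 'a set" where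
  "live G X = {v \<in> verts G - closed_nbhd G X. \<exists>w \<in> verts G - closed_nbhd G X. v \<rightarrow>\<^bsub>G\<^esub> w}"

context graph
begin

lemma adj_sym: "u \<rightarrow> v \<longleftrightarrow> v \<rightarrow> u"
  using arcs_ends_symmetric[OF sym_arcs] by blast

lemma adj_irrefl [simp]: "\<not> u \<rightarrow> u"
  using adj_not_same by blast

lemma nbhd_subset: "nbhd G x \<subseteq> verts G"
  by (auto simp: nbhd_def dest: adj_in_verts)

lemma finite_nbhd [simp]: "finite (nbhd G x)"
  using finite_subset[OF nbhd_subset finite_verts] .

lemma live_subset: "live G X \<subseteq> verts G"
  by (auto simp: live_def)

lemma finite_live [simp]: "finite (live G X)"
  using finite_subset[OF live_subset finite_verts] .

lemma live_has_live_neighbour: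
  assumes "v \<in> live G X"
  obtains w where "w \<in> live G X" "v \<rightarrow> w"
  using assms adj_sym by (auto simp: live_def)

text \<open>Selecting \<open>x\<close> adds just its closed neighbourhood to the dominated set, so
  liveness can be updated from the old live set without reference to \<open>X\<close>. The witness
  \<open>w\<close> may be taken live because adjacent undominated vertices keep each other
  live.\<close>

lemma live_insert:
  "v \<in> live G (insert x X) \<longleftrightarrow>
    v \<in> live G X \<and> v \<notin> insert x (nbhd G x) \<and>
    (\<exists>w \<in> live G X. v \<rightarrow> w \<and> w \<notin> insert x (nbhd G x))"
proof -
  have "closed_nbhd G (insert x X) = closed_nbhd G X \<union> insert x (nbhd G x)"
    using nbhd_subset by (auto simp: closed_nbhd_def nbhd_def)
  then show ?thesis
    using adj_sym by (auto simp: live_def)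
qed

text \<open>In a component with at least two vertices, every vertex has a walk to another one, and
  the first step of this walk makes it live. Conversely, the set reachable from a live vertex is a
  component containing that vertex and a neighbour. From here on the game is analysed through live
  vertices alone.\<close>

lemma playable_iff_live:
  "x \<in> playable G X \<longleftrightarrow> x \<in> verts G \<and> (\<exists>y \<in> live G X. x = y \<or> x \<rightarrow> y)"
proof -
  define W where "W = verts G - closed_nbhd G X"
  have ind: "induced_subgraph (G \<restriction> W) G"
    by (rule induced_induce) (auto simp: W_def)
  have "digraph (G \<restriction> W)"
    by (rule digraph_subgraph[OF induced_imp_subgraph[OF ind]])
  moreover have "symmetric (G \<restriction> W)"
    by (rule induced_graph_imp_symmetric[OF sym_arcs ind])
  ultimately interpret H: graph "G \<restriction> W"
    by (rule digraph.graphI)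
  have adj: "u \<rightarrow>\<^bsub>G \<restriction> W\<^esub> v \<longleftrightarrow> u \<in> W \<and> v \<in> W \<and> u \<rightarrow> v" for u v
    by (auto simp: arcs_ends_conv induce_subgraph_def)
  have "(\<exists>C \<in> H.sccs. 2 \<le> card (verts C) \<and> y \<in> verts C) \<longleftrightarrow> y \<in> live G X" for y
  proof
    assume "\<exists>C \<in> H.sccs. 2 \<le> card (verts C) \<and> y \<in> verts C"
    then obtain C where C: "C \<in> H.sccs" "2 \<le> card (verts C)" "y \<in> verts C"
      by blast
    have "\<not> verts C \<subseteq> {y}"
      using C(2) card_mono[of "{y}" "verts C"] by auto
    then obtain z where z: "z \<in> verts C" "z \<noteq> y"
      by blast
    from C(1) have sub: "subgraph C (G \<restriction> W)" and sc: "strongly_connected C"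
      by (auto simp: H.sccs_def dest: induced_imp_subgraph)
    from sc z C(3) have "y \<rightarrow>\<^sup>*\<^bsub>C\<^esub> z"
      by (auto simp: strongly_connected_def)
    then obtain w where "y \<rightarrow>\<^bsub>C\<^esub> w"
      using z(2) by (cases rule: pre_digraph.converse_reachable_cases) auto
    then have "y \<rightarrow>\<^bsub>G \<restriction> W\<^esub> w"
      using sub by (rule H.adj_mono)
    then show "y \<in> live G X"
      unfolding adj by (auto simp: live_def W_def)
  next
    assume "y \<in> live G X"
    then obtain w where yw: "y \<rightarrow>\<^bsub>G \<restriction> W\<^esub> w"
      unfolding adj by (auto simp: live_def W_def)
    let ?R = "{v. y \<rightarrow>\<^sup>*\<^bsub>G \<restriction> W\<^esub> v}"
    have y: "y \<in> verts (G \<restriction> W)"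
      using yw by (rule H.adj_in_verts)
    have "?R \<subseteq> verts (G \<restriction> W)"
      using H.reachable_in_verts by blast
    then have "finite ?R"
      using H.finite_verts finite_subset by blast
    moreover have "{y, w} \<subseteq> ?R"
      using y yw by auto
    ultimately have "card {y, w} \<le> card ?R"
      by (rule card_mono)
    moreover have "y \<noteq> w"
      using yw H.adj_irrefl by blast
    ultimately have "2 \<le> card (verts ((G \<restriction> W) \<restriction> ?R))"
      by simp
    moreover have "y \<in> verts ((G \<restriction> W) \<restriction> ?R)"
      using y by simp
    ultimately show "\<exists>C \<in> H.sccs. 2 \<le> card (verts C) \<and> y \<in> verts C"
      using H.induce_reachable_is_in_sccs[OF y] by blast
  qed
  then show ?thesis
    unfolding playable_def W_def by blast
qed

lemma live_playable: "x \<in> live G X \<Longrightarrow> x \<in> playable G X"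
  using live_subset by (auto simp: playable_iff_live)

section \<open>One-step bounds on the game value\<close>

lemma moves_left_no_move: "playable G X = {} \<Longrightarrow> moves_left G p X = 0"
  by (subst moves_left.simps) simp

lemma finite_playable [simp]: "finite (playable G X)"
  using finite_subset[OF playable_subset finite_Diff[OF finite_verts]] .

lemma moves_left_Dominator_le:
  assumes "x \<in> playable G X"
  shows "moves_left G Dominator X \<le> 1 + moves_left G Staller (insert x X)"
proof -
  have "playable G X \<noteq> {}"
    using assms by auto
  then show ?thesis
    using assms by (subst moves_left.simps) (auto intro!: Min_le)
qed

lemma moves_left_Dominator_ge:
  assumes "playable G X \<noteq> {}"
    and "\<And>x. x \<in> playable G X \<Longrightarrow> k \<le> moves_left G Staller (insert x X)"
  shows "1 + k \<le> moves_left G Dominator X"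
proof -
  have "k \<le> Min ((\<lambda>x. moves_left G Staller (insert x X)) ` playable G X)"
    using assms by (intro Min.boundedI) auto
  then show ?thesis
    using assms(1) by (subst moves_left.simps) simp
qed

lemma moves_left_Staller_le:
  assumes "\<And>y. y \<in> playable G X \<Longrightarrow> moves_left G Dominator (insert y X) \<le> k"
  shows "moves_left G Staller X \<le> 1 + k"
proof (cases "playable G X = {}")
  case True
  then show ?thesis
    by (simp add: moves_left_no_move)
next
  case False
  then have "Max ((\<lambda>y. moves_left G Dominator (insert y X)) ` playable G X) \<le> k"
    using assms by (intro Max.boundedI) auto
  then show ?thesis
    using False by (subst moves_left.simps) simp
qed

lemma moves_left_Staller_ge:
  assumes "y \<in> playable G X"
  shows "1 + moves_left G Dominator (insert y X) \<le> moves_left G Staller X"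
proof -
  have "playable G X \<noteq> {}"
    using assms by auto
  then show ?thesis
    using assms by (subst (2) moves_left.simps) (auto intro!: Max_ge)
qed

text \<open>One full round: Dominator's two-move cost is paid by a loss of 4 from the budget
  \<open>c\<close>, while a single move without reply costs only 2. The budget is left arbitrary, so
  that it can be the number of live vertices for the bound and one less for strictness.\<close>

lemma moves_left_round:
  assumes "x \<in> playable G X" and "2 \<le> c"
    and "\<And>y. y \<in> playable G (insert x X) \<Longrightarrow>
      2 * moves_left G Dominator (insert y (insert x X)) + 4 \<le> c"
  shows "2 * moves_left G Dominator X \<le> c"
proof (cases "playable G (insert x X) = {}")
  case True
  then show ?thesis
    using moves_left_Dominator_le[OF assms(1)] \<open>2 \<le> c\<close> by (simp add: moves_left_no_move)
next
  case False
  then obtain y where "y \<in> playable G (insert x X)"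
    by blast
  \<comment> \<open>An available reply forces this, so the truncated subtraction
    \<open>c - 4\<close> below is a true difference.\<close>
  then have "4 \<le> c"
    using assms(3) by fastforce
  have "moves_left G Staller (insert x X) \<le> 1 + (c - 4) div 2"
    using assms(3) by (intro moves_left_Staller_le) fastforce
  then show ?thesis
    using moves_left_Dominator_le[OF assms(1)] \<open>4 \<le> c\<close> by linarith
qed

section \<open>Counting the live vertices killed by a move\<close>

lemma card_live_insert:
  assumes "S \<subseteq> live G X" and "S \<inter> live G (insert x X) = {}"
  shows "card (live G (insert x X)) + card S \<le> card (live G X)"
proof -
  have "live G (insert x X) \<union> S \<subseteq> live G X"
    using assms(1) live_insert by blast
  then have "card (live G (insert x X) \<union> S) \<le> card (live G X)"
    by (rule card_mono[OF finite_live])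
  then show ?thesis
    using assms finite_subset[OF assms(1)] by (subst (asm) card_Un_disjoint) auto
qed

lemma card_live_playable:
  assumes "y \<in> playable G X"
  shows "card (live G (insert y X)) + 1 \<le> card (live G X)"
proof -
  obtain v where v: "v \<in> live G X" "y = v \<or> y \<rightarrow> v"
    using assms by (auto simp: playable_iff_live)
  then have "{v} \<inter> live G (insert y X) = {}"
    by (auto simp: live_insert nbhd_def)
  then show ?thesis
    using card_live_insert[of "{v}" X y] v by simp
qed

lemma card_live_live:
  assumes "x \<in> live G X"
  shows "card (live G (insert x X)) + 1 + card (nbhd G x \<inter> live G X) \<le> card (live G X)"
proof -
  have "insert x (nbhd G x \<inter> live G X) \<inter> live G (insert x X) = {}"
    by (auto simp: live_insert)
  moreover have "x \<notin> nbhd G x"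
    by (simp add: nbhd_def)
  ultimately show ?thesis
    using card_live_insert[of "insert x (nbhd G x \<inter> live G X)" X x] assms
    by simp
qed

text \<open>No live vertex is isolated among the live ones, so the degree bound makes the live graph
  a perfect matching. Dominating one end \<open>v\<close> of an edge takes from the other end
  \<open>w\<close> its only live neighbour, and both die, even if \<open>y\<close> itself is not
  live.\<close>

lemma card_live_matching:
  assumes deg: "\<And>v. v \<in> live G X \<Longrightarrow> card (nbhd G v \<inter> live G X) \<le> 1"
    and y: "y \<in> playable G X"
  shows "card (live G (insert y X)) + 2 \<le> card (live G X)"
proof -
  obtain v where v: "v \<in> live G X" "y = v \<or> y \<rightarrow> v"
    using y by (auto simp: playable_iff_live)
  obtain w where w: "w \<in> live G X" "v \<rightarrow> w"
    using live_has_live_neighbour[OF v(1)] .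
  \<comment> \<open>The degree bound at \<open>w\<close> is already exhausted by
    \<open>v\<close>.\<close>
  have "z = v" if "z \<in> live G X" "w \<rightarrow> z" for z
    using card_le_Suc0_iff_eq[of "nbhd G w \<inter> live G X"] deg[OF w(1)] that v(1) w(2) adj_sym
    by (auto simp: nbhd_def)
  then have "{v, w} \<inter> live G (insert y X) = {}"
    using v by (auto simp: live_insert nbhd_def)
  moreover have "card {v, w} = 2"
    using w(2) by (cases "v = w") auto
  ultimately show ?thesis
    using card_live_insert[of "{v, w}" X y] v w by simp
qed

section \<open>The upper bound and criteria for strictness\<close>

lemma twice_moves_left_le: "2 * moves_left G Dominator X \<le> card (live G X)"
proof (induction "card (live G X)" arbitrary: X rule: less_induct)
  case less
  show ?case
  proof (cases "playable G X = {}")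
    case True
    then show ?thesis
      by (simp add: moves_left_no_move)
  next
    case False
    then obtain u where "u \<in> live G X"
      by (auto simp: playable_iff_live)
    \<comment> \<open>The induction hypothesis after a full round, combined with
      \<open>moves_left_round\<close>: each case below only has to show that the round kills four
      live vertices.\<close>
    have *: ?thesis if x: "x \<in> playable G X" and "2 \<le> card (live G X)"
      and two: "\<And>y. y \<in> playable G (insert x X) \<Longrightarrow>
        card (live G (insert y (insert x X))) + 4 \<le> card (live G X)" for x
    proof (rule moves_left_round[OF x])
      fix y assume "y \<in> playable G (insert x X)"
      from two[OF this] less[of "insert y (insert x X)"]
      show "2 * moves_left G Dominator (insert y (insert x X)) + 4 \<le> card (live G X)"
        by linarith
    qed fact
    show ?thesis
    proof (cases "\<exists>x \<in> live G X. 2 \<le> card (nbhd G x \<inter> live G X)")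
      case True
      then obtain x where x: "x \<in> live G X" "2 \<le> card (nbhd G x \<inter> live G X)"
        by blast
      then have "card (live G (insert x X)) + 3 \<le> card (live G X)"
        using card_live_live[OF x(1)] by linarith
      \<comment> \<open>Three kills by \<open>x\<close> and at least one by any reply.\<close>
      then show ?thesis
        using card_live_playable[of _ "insert x X"] live_playable[OF x(1)]
        by (intro *[of x]) fastforce+
    next
      case False
      then have deg: "card (nbhd G v \<inter> live G X) \<le> 1" if "v \<in> live G X" for v
        using that by fastforce
      have step: "card (live G (insert u X)) + 2 \<le> card (live G X)"
        using card_live_matching[OF deg live_playable[OF \<open>u \<in> live G X\<close>]] .
      \<comment> \<open>The live set only shrinks, so the degree bound survives Dominator's move and
        the reply also kills two.\<close>
      have "card (nbhd G v \<inter> live G (insert u X)) \<le> 1" if "v \<in> live G (insert u X)" for v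
      proof -
        have "card (nbhd G v \<inter> live G (insert u X)) \<le> card (nbhd G v \<inter> live G X)"
          by (intro card_mono) (auto simp: live_insert)
        also have "\<dots> \<le> 1"
          using that by (intro deg) (simp add: live_insert)
        finally show ?thesis .
      qed
      then have "card (live G (insert y (insert u X))) + 2 \<le> card (live G (insert u X))"
        if "y \<in> playable G (insert u X)" for y
        using card_live_matching that by blast
      with step show ?thesis
        using live_playable[OF \<open>u \<in> live G X\<close>] by (intro *[of u]) fastforce+
    qed
  qed
qed

lemma twice_moves_left_less:
  assumes "x \<in> playable G X" and "card (live G (insert x X)) + 4 \<le> card (live G X)"
  shows "2 * moves_left G Dominator X < card (live G X)"
proof -
  \<comment> \<open>Four kills and at least one more by the reply make five, one above the cost of a
    round. The budget can therefore start one lower.\<close>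
  have "2 * moves_left G Dominator X \<le> card (live G X) - 1"
  proof (rule moves_left_round[OF assms(1)])
    fix y assume "y \<in> playable G (insert x X)"
    with card_live_playable[OF this] assms(2) twice_moves_left_le[of "insert y (insert x X)"]
    show "2 * moves_left G Dominator (insert y (insert x X)) + 4 \<le> card (live G X) - 1"
      by linarith
  qed (use assms(2) in linarith)
  then show ?thesis
    using assms(2) by linarith
qed

text \<open>
  Dominator selects the third vertex of the path starting at a leaf of the live graph,
  so that the leaf is isolated.
\<close>

lemma twice_moves_left_less_leaf:
  assumes live: "v \<in> live G X" "w \<in> live G X" "x \<in> live G X" "y \<in> live G X"
    and adj: "w \<rightarrow> x" "x \<rightarrow> y" and "y \<noteq> w"
    and leaf: "nbhd G v \<inter> live G X = {w}" and "v \<noteq> x"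
  shows "2 * moves_left G Dominator X < card (live G X)"
proof (rule twice_moves_left_less[OF live_playable[OF live(3)]])
  have nbhd_v: "v \<rightarrow> z \<longleftrightarrow> z = w" if "z \<in> live G X" for z
  proof -
    have "z \<in> nbhd G v \<inter> live G X \<longleftrightarrow> z = w"
      by (simp add: leaf)
    then show ?thesis
      using that by (simp add: nbhd_def)
  qed
  have vw: "v \<rightarrow> w"
    using nbhd_v live(2) by blast
  \<comment> \<open>Otherwise \<open>x\<close> would be a live neighbour of the leaf, hence equal to
    \<open>w\<close>, against \<open>w \<rightarrow> x\<close>.\<close>
  have "y \<noteq> v"
    using nbhd_v[OF live(3)] adj adj_sym[of x v] by auto
  have "w \<in> insert x (nbhd G x)" "y \<in> insert x (nbhd G x)"
    using adj adj_sym[of x w] by (auto simp: nbhd_def)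
  then have "{v, w, x, y} \<inter> live G (insert x X) = {}"
    using nbhd_v by (auto simp: live_insert)
  moreover have "w \<noteq> x" "x \<noteq> y" "v \<noteq> w"
    using adj vw by auto
  then have "card {v, w, x, y} = 4"
    using \<open>y \<noteq> w\<close> \<open>v \<noteq> x\<close> \<open>y \<noteq> v\<close> by simp
  ultimately show "card (live G (insert x X)) + 4 \<le> card (live G X)"
    using card_live_insert[of "{v, w, x, y}" X x] live by simp
qed

section \<open>The initial position of a connected graph\<close>

lemma connected_closed_eq_verts:
  assumes "Digraph_Component.connected G" and "u \<in> S" and "S \<subseteq> verts G"
    and closed: "\<And>u. u \<in> S \<Longrightarrow> nbhd G u \<subseteq> S"
  shows "S = verts G"
proof -
  have "v \<in> S" if "v \<in> verts G" for v
  proof -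
    \<comment> \<open>Connectedness speaks of the symmetric closure, whose reachability agrees with
      that of the symmetric digraph itself.\<close>
    have "u \<rightarrow>\<^sup>* v"
      using assms(1-3) that reachable_mk_symmetric_eq[OF sym_arcs]
      by (auto simp: Digraph_Component.connected_def strongly_connected_def)
    then show ?thesis
      by (induction rule: reachable_induct) (use assms(2) closed in \<open>auto simp: nbhd_def\<close>)
  qed
  then show ?thesis
    using assms(3) by blast
qed

lemma closed_nbhd_empty [simp]: "closed_nbhd G {} = {}"
  by (simp add: closed_nbhd_def)

text \<open>With nothing dominated, live means having a neighbour. An isolated vertex would form a
  set closed under neighbours and so be the whole graph.\<close>

lemma live_empty:
  assumes "Digraph_Component.connected G" and "2 \<le> card (verts G)"
  shows "live G {} = verts G"
proof -
  have "\<exists>w. v \<rightarrow> w" if "v \<in> verts G" for v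
  proof (rule ccontr)
    assume "\<not> (\<exists>w. v \<rightarrow> w)"
    then have "{v} = verts G"
      using that by (intro connected_closed_eq_verts[OF assms(1)]) (auto simp: nbhd_def)
    then have "card (verts G) = card {v}"
      by simp
    then show False
      using assms(2) by simp
  qed
  then have "\<exists>w \<in> verts G. v \<rightarrow> w" if "v \<in> verts G" for v
    using that adj_in_verts(2) by blast
  then show ?thesis
    by (auto simp: live_def)
qed

lemma less_of_degree_ge_3:
  assumes "live G {} = verts G" and "x \<in> verts G" and "3 \<le> card (nbhd G x)"
  shows "2 * moves_left G Dominator {} < card (verts G)"
proof -
  have "card (live G {x}) + 4 \<le> card (live G {})"
    using card_live_live[of x "{}"] assms nbhd_subset[of x] by (simp add: Int_absorb2)
  then show ?thesis
    using twice_moves_left_less[of x "{}"] live_playable[of x "{}"] assms by simp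
qed

text \<open>A path \<open>v\<close>, \<open>w\<close>, \<open>x\<close>, \<open>y\<close> is grown
  from the leaf, to be handed to \<open>twice_moves_left_less_leaf\<close>. If it could not be
  extended, its at most three vertices would be closed under neighbours and hence all of the
  graph.\<close>

lemma less_of_leaf:
  assumes conn: "Digraph_Component.connected G" and n: "4 \<le> card (verts G)"
    and deg: "\<And>x. x \<in> verts G \<Longrightarrow> card (nbhd G x) \<le> 2"
    and v: "v \<in> verts G" "card (nbhd G v) = 1"
  shows "2 * moves_left G Dominator {} < card (verts G)"
proof -
  have live: "live G {} = verts G"
    using live_empty conn n by simp
  have small: False
    if "u \<in> S" "S \<subseteq> verts G" "\<And>u. u \<in> S \<Longrightarrow> nbhd G u \<subseteq> S" "card S \<le> 3" for u S
    using connected_closed_eq_verts[OF conn that(1-3)] that(4) n by simp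
  obtain w where nv: "nbhd G v = {w}"
    using v(2) card_1_singletonE by blast
  then have "w \<in> nbhd G v"
    by simp
  then have vw: "v \<rightarrow> w" "w \<rightarrow> v" "w \<in> verts G"
    using adj_sym[of v w] nbhd_subset[of v] by (auto simp: nbhd_def)
  have "\<exists>x. w \<rightarrow> x \<and> x \<noteq> v"
  proof (rule ccontr)
    assume "\<not> (\<exists>x. w \<rightarrow> x \<and> x \<noteq> v)"
    then have "nbhd G w \<subseteq> {v, w}"
      by (auto simp: nbhd_def)
    moreover have "card {v, w} \<le> 3"
      by (simp add: card_insert_if)
    ultimately show False
      using small[of v "{v, w}"] nv v vw by auto
  qed
  then obtain x where x: "w \<rightarrow> x" "x \<noteq> v"
    by blast
  have xV: "x \<in> verts G"
    using adj_in_verts(2)[OF x(1)] .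
  \<comment> \<open>The degree bound leaves \<open>w\<close> no third neighbour, as the closure of
    \<open>{v, w, x}\<close> below requires.\<close>
  have nw: "nbhd G w = {v, x}"
  proof (rule card_seteq[symmetric])
    show "{v, x} \<subseteq> nbhd G w"
      using x vw by (simp add: nbhd_def)
    show "card (nbhd G w) \<le> card {v, x}"
      using deg[OF vw(3)] x(2) by simp
  qed simp
  have "\<exists>y. x \<rightarrow> y \<and> y \<noteq> w"
  proof (rule ccontr)
    assume "\<not> (\<exists>y. x \<rightarrow> y \<and> y \<noteq> w)"
    then have "nbhd G x \<subseteq> {v, w, x}"
      by (auto simp: nbhd_def)
    moreover have "card {v, w, x} \<le> 3"
      by (simp add: card_insert_if)
    ultimately show False
      using small[of v "{v, w, x}"] nv nw v vw xV by auto
  qed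
  then obtain y where y: "x \<rightarrow> y" "y \<noteq> w"
    by blast
  have "y \<in> verts G"
    using adj_in_verts(2)[OF y(1)] .
  then show ?thesis
    using twice_moves_left_less_leaf[of v "{}" w x y] live v(1) vw(3) xV x y nv by simp
qed

end

section \<open>Connected 2-regular graphs as cycles\<close>

text \<open>The map \<open>f\<close> walks along the cycle over all natural numbers, injective on
  the first \<open>n\<close> of them and back at the start at index \<open>n\<close>. Thus
  neighbours are found by shifting the index, without reduction modulo \<open>n\<close>; only index
  0, having no predecessor, needs its own clause.\<close>

locale cycle_enum = graph +
  fixes f :: "nat \<Rightarrow> 'a" and n :: nat
  assumes n: "3 \<le> n" and inj: "inj_on f {..<n}" and verts: "f ` {..<n} = verts G"
    and wrap: "f n = f 0" and nbhd_0: "nbhd G (f 0) = {f (Suc 0), f (n - 1)}"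
    and nbhd_Suc: "nbhd G (f (Suc k)) = {f k, f (Suc (Suc k))}"

text \<open>Start at \<open>v\<close> and never turn back; 2-regularity determines each next vertex.
  The first revisited vertex must be the start, since any other has both its neighbours on the walk
  already. The closed walk then contains all neighbours of its vertices, so connectedness makes it
  the whole graph.\<close>

lemma (in graph) cycle_enumE:
  assumes conn: "Digraph_Component.connected G"
    and deg: "\<And>x. x \<in> verts G \<Longrightarrow> card (nbhd G x) = 2"
    and v: "v \<in> verts G"
  obtains f where "cycle_enum G f (card (verts G))" "f 0 = v"
proof -
  \<comment> \<open>The state is the last traversed arc: the previous vertex has to be remembered
    for \<open>?Q\<close> to forbid turning back.\<close>
  let ?P = "\<lambda>n (u, w). u \<rightarrow> w \<and> (n = (0 :: nat) \<longrightarrow> u = v)"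
  let ?Q = "\<lambda>n (u, w) (u', w'). u' = w \<and> nbhd G w = {u, w'} \<and> w' \<noteq> u"
  have "\<exists>g. \<forall>n. ?P n (g n) \<and> ?Q n (g n) (g (Suc n))"
  proof (rule dependent_nat_choice)
    have "nbhd G v \<noteq> {}"
      using deg[OF v] by auto
    then obtain w where "w \<in> nbhd G v"
      by blast
    then show "\<exists>x. ?P 0 x"
      by (auto simp: nbhd_def)
  next
    fix x n assume "?P n x"
    then obtain u w where x: "x = (u, w)" and uw: "u \<rightarrow> w"
      by auto
    then have "u \<in> nbhd G w" "w \<in> verts G"
      using adj_sym[of u w] adj_in_verts by (auto simp: nbhd_def)
    then obtain a b where "nbhd G w = {a, b}" "a \<noteq> b" "u = a \<or> u = b"
      using deg[of w] by (auto simp: card_2_iff)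
    then have "nbhd G w = {u, if u = a then b else a}" "(if u = a then b else a) \<noteq> u"
      by auto
    then obtain w' where "nbhd G w = {u, w'}" "w' \<noteq> u"
      by blast
    moreover from this have "w' \<in> nbhd G w"
      by simp
    ultimately show "\<exists>y. ?P (Suc n) y \<and> ?Q n x y"
      using x by (auto simp: nbhd_def)
  qed
  then obtain g where "\<forall>n. ?P n (g n) \<and> ?Q n (g n) (g (Suc n))" ..
  note g = this[THEN spec, THEN conjunct1] this[THEN spec, THEN conjunct2]
  define f where "f k = fst (g k)" for k
  have f_Suc: "f (Suc k) = snd (g k)" for k
    using g(2)[of k] by (auto simp: f_def split: prod.splits)
  have f0: "f 0 = v"
    using g(1)[of 0] by (auto simp: f_def split: prod.splits)
  have adj: "f k \<rightarrow> f (Suc k)" for k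
    using g(1)[of k] unfolding f_Suc by (auto simp: f_def split: prod.splits)
  have nb: "nbhd G (f (Suc k)) = {f k, f (Suc (Suc k))}" and ne: "f (Suc (Suc k)) \<noteq> f k" for k
    using g(2)[of k] unfolding f_Suc by (auto simp: f_def split: prod.splits)
  have fV: "f k \<in> verts G" for k
    using adj_in_verts(1)[OF adj] .
  have "\<not> inj f"
    using finite_subset[of "range f" "verts G"] fV range_inj_infinite by auto
  then have "\<exists>j. f j \<in> f ` {..<j}"
    unfolding inj_def by (metis image_eqI lessThan_iff linorder_neqE_nat)
  \<comment> \<open>The first index at which the walk meets an earlier vertex; it turns out to be
    the length of the cycle.\<close>
  define p where "p = (LEAST j. f j \<in> f ` {..<j})"
  have p: "f p \<in> f ` {..<p}"
    unfolding p_def using \<open>\<exists>j. f j \<in> f ` {..<j}\<close> by (rule LeastI_ex)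
  have least: "f j \<noteq> f i" if "i < j" "j < p" for i j
    using not_less_Least[of j "\<lambda>j. f j \<in> f ` {..<j}"] that unfolding p_def by auto
  have inj: "inj_on f {..<p}"
  proof (rule inj_onI)
    fix i j assume "i \<in> {..<p}" "j \<in> {..<p}" "f i = f j"
    then show "i = j"
      using least[of i j] least[of j i] by (metis lessThan_iff linorder_neqE_nat)
  qed
  obtain i where i: "i < p" "f p = f i"
    using p by auto
  obtain q where q: "p = Suc q"
    using i(1) by (cases p) auto
  \<comment> \<open>Otherwise the neighbour \<open>f q\<close> of \<open>f p = f i\<close> must be
    one of the two vertices next to \<open>f i\<close> on the walk, \<open>f h\<close> or
    \<open>f (Suc i)\<close>.\<close>
  have "i = 0"
  proof (rule ccontr)
    assume "i \<noteq> 0"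
    then obtain h where h: "i = Suc h"
      by (cases i) auto
    have "f q \<in> nbhd G (f p)"
      using adj[of q] adj_sym q by (simp add: nbhd_def)
    then have "f q = f h \<or> f q = f (Suc i)"
      using nb[of h] i(2) h by auto
    moreover have "f q \<noteq> f h"
      using least[of h q] h i(1) q by simp
    moreover have "f q \<noteq> f (Suc i)"
    proof
      \<comment> \<open>Here \<open>Suc i = p\<close> would give a loop at \<open>f q\<close>,
        \<open>Suc i = q\<close> a turn back from \<open>f i\<close> to itself in two steps, and
        \<open>Suc i < q\<close> a repetition before \<open>p\<close>.\<close>
      assume eq: "f q = f (Suc i)"
      have "Suc i \<noteq> p"
        using eq adj[of q] q by (metis adj_irrefl)
      then have "Suc i = q \<or> Suc i < q"
        using i(1) q by linarith
      then show False
        using eq least[of "Suc i" q] q ne[of i] i(2) by auto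
    qed
    ultimately show False
      by blast
  qed
  then have fp: "f p = f 0"
    using i(2) by simp
  \<comment> \<open>Length 1 would be a loop, and length 2 would be a turn back.\<close>
  have "p \<noteq> 1" "p \<noteq> 2"
    using fp adj[of 0] ne[of 0] adj_irrefl by (auto simp: numeral_2_eq_2)
  then have p3: "3 \<le> p"
    using i(1) by linarith
  have nb0: "nbhd G (f 0) = {f 1, f q}"
  proof (rule card_seteq[symmetric])
    show "{f 1, f q} \<subseteq> nbhd G (f 0)"
      using adj[of 0] adj[of q] adj_sym[of "f q"] q fp by (simp add: nbhd_def)
    have "f q \<noteq> f 1"
      using least[of 1 q] p3 q by simp
    then show "card (nbhd G (f 0)) \<le> card {f 1, f q}"
      using deg[OF fV] by simp
  qed simp
  have "f ` {..<p} = verts G"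
  proof (rule connected_closed_eq_verts[OF conn])
    show "f 0 \<in> f ` {..<p}"
      using p3 by simp
    show "f ` {..<p} \<subseteq> verts G"
      using fV by blast
    fix u assume "u \<in> f ` {..<p}"
    then obtain k where k: "k < p" "u = f k"
      by auto
    show "nbhd G u \<subseteq> f ` {..<p}"
    proof (cases k)
      case 0
      then show ?thesis
        using k nb0 p3 q by simp
    next
      case (Suc h)
      have "f (Suc k) \<in> f ` {..<p}"
        using k fp p3 by (cases "Suc k = p") auto
      then show ?thesis
        using k Suc nb[of h] by simp
    qed
  qed
  moreover from this have "card (verts G) = p"
    using card_image[OF inj] by simp
  ultimately have "cycle_enum G f (card (verts G))"
    using p3 inj fp nb0 nb q by unfold_locales simp_all
  then show ?thesis
    using that f0 by blast
qed

section \<open>Isomorphism with the 6-cycle\<close>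

text \<open>The arcs of \<open>with_proj H\<close> are pairs of their ends and \<open>G\<close> has
  no parallel arcs, so the arc part of an isomorphism is determined by its vertex part.\<close>

lemma (in graph) digraph_iso_with_proj_iff:
  assumes H: "parcs H \<subseteq> pverts H \<times> pverts H"
  shows "digraph_iso G (with_proj H) \<longleftrightarrow>
    (\<exists>\<phi>. bij_betw \<phi> (verts G) (pverts H) \<and>
      (\<forall>u \<in> verts G. \<forall>v \<in> verts G. u \<rightarrow> v \<longleftrightarrow> (\<phi> u, \<phi> v) \<in> parcs H))"
proof
  assume "digraph_iso G (with_proj H)"
  then obtain h where h: "digraph_isomorphism h" and eq: "with_proj H = app_iso h G"
    by (auto simp: digraph_iso_def)
  let ?\<phi> = "iso_verts h"
  have eqs: "pverts H = ?\<phi> ` verts G" "parcs H = iso_arcs h ` arcs G"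
    "iso_tail h = fst" "iso_head h = snd"
    using arg_cong[OF eq, of verts] arg_cong[OF eq, of arcs]
      arg_cong[OF eq, of tail] arg_cong[OF eq, of head] by simp_all
  have inj: "inj_on ?\<phi> (verts G)"
    using h by (rule digraph_isomorphism_inj_on_verts)
  have iso_arcs: "iso_arcs h e = (?\<phi> (tail G e), ?\<phi> (head G e))" if "e \<in> arcs G" for e
    using iso_verts_tail[OF h that] iso_verts_head[OF h that] eqs(3,4) by (simp add: prod_eq_iff)
  have "u \<rightarrow> v \<longleftrightarrow> (?\<phi> u, ?\<phi> v) \<in> parcs H" if "u \<in> verts G" "v \<in> verts G" for u v
  proof -
    have "(?\<phi> u, ?\<phi> v) \<in> parcs H \<longleftrightarrow>
      (\<exists>e \<in> arcs G. ?\<phi> u = ?\<phi> (tail G e) \<and> ?\<phi> v = ?\<phi> (head G e))"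
      using iso_arcs by (auto simp: eqs(2) image_iff)
    also have "\<dots> \<longleftrightarrow> (\<exists>e \<in> arcs G. u = tail G e \<and> v = head G e)"
      using inj that by (auto simp: inj_on_eq_iff)
    finally show ?thesis
      by (auto simp: arcs_ends_conv image_iff)
  qed
  then show "\<exists>\<phi>. bij_betw \<phi> (verts G) (pverts H) \<and>
      (\<forall>u \<in> verts G. \<forall>v \<in> verts G. u \<rightarrow> v \<longleftrightarrow> (\<phi> u, \<phi> v) \<in> parcs H)"
    using inj eqs(1) by (intro exI[of _ ?\<phi>]) (auto simp: bij_betw_def)
next
  assume "\<exists>\<phi>. bij_betw \<phi> (verts G) (pverts H) \<and>
      (\<forall>u \<in> verts G. \<forall>v \<in> verts G. u \<rightarrow> v \<longleftrightarrow> (\<phi> u, \<phi> v) \<in> parcs H)"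
  then obtain \<phi> where bij: "bij_betw \<phi> (verts G) (pverts H)"
    and adj: "\<And>u v. u \<in> verts G \<Longrightarrow> v \<in> verts G \<Longrightarrow> u \<rightarrow> v \<longleftrightarrow> (\<phi> u, \<phi> v) \<in> parcs H"
    by blast
  let ?h = "\<lparr> iso_verts = \<phi>, iso_arcs = \<lambda>e. (\<phi> (tail G e), \<phi> (head G e)),
    iso_head = snd, iso_tail = fst \<rparr>"
  have inj: "inj_on \<phi> (verts G)"
    using bij by (rule bij_betw_imp_inj_on)
  \<comment> \<open>Distinct arcs have distinct end pairs, and the injective \<open>\<phi>\<close>
    keeps these apart.\<close>
  have "inj_on (\<lambda>e. (\<phi> (tail G e), \<phi> (head G e))) (arcs G)"
    using no_multi_arcs by (auto intro!: inj_onI simp: inj_on_eq_iff[OF inj] arc_to_ends_def)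
  then have "digraph_isomorphism ?h"
    using inj wf_digraph by (simp add: digraph_isomorphism_def)
  moreover have "with_proj H = app_iso ?h G"
  proof -
    have "parcs H = (\<lambda>e. (\<phi> (tail G e), \<phi> (head G e))) ` arcs G"
    proof (intro set_eqI iffI)
      fix a assume a: "a \<in> parcs H"
      then have "fst a \<in> \<phi> ` verts G" "snd a \<in> \<phi> ` verts G"
        using H bij by (auto simp: bij_betw_def)
      then obtain u v where uv: "u \<in> verts G" "v \<in> verts G" "a = (\<phi> u, \<phi> v)"
        by (metis imageE prod.collapse)
      then have "u \<rightarrow> v"
        using a adj by simp
      then show "a \<in> (\<lambda>e. (\<phi> (tail G e), \<phi> (head G e))) ` arcs G"
        using uv(3) by (auto simp: arcs_ends_conv)
    next
      fix a assume "a \<in> (\<lambda>e. (\<phi> (tail G e), \<phi> (head G e))) ` arcs G"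
      then obtain e where e: "e \<in> arcs G" "a = (\<phi> (tail G e), \<phi> (head G e))"
        by blast
      then have "tail G e \<rightarrow> head G e"
        by (auto simp: arcs_ends_conv)
      then show "a \<in> parcs H"
        using e adj by simp
    qed
    then show ?thesis
      using bij by (simp add: with_proj_def app_iso_def bij_betw_def)
  qed
  ultimately show "digraph_iso G (with_proj H)"
    by (auto simp: digraph_iso_def)
qed

text \<open>The condition giving \<open>i\<close> as successor of \<open>j\<close> is solved for
  \<open>j\<close>, so that both neighbours of \<open>i\<close> become explicit. Adding 5 instead of
  subtracting 1 gives the predecessor of 0 correctly.\<close>

lemma parcs_cycle_graph_6:
  "(i, j) \<in> parcs (cycle_graph 6) \<longleftrightarrow> i < 6 \<and> j \<in> {(i + 1) mod 6, (i + 5) mod 6}"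
proof (cases "i < 6 \<and> j < 6")
  case True
  have succ: "(k + 1) mod 6 = (if k = 5 then 0 else k + 1)" if "k < 6" for k :: nat
    using that by simp
  have pred: "(k + 5) mod 6 = (if k = 0 then 5 else k - 1)" if "k < 6" for k :: nat
    using that by (cases k) simp_all
  have "i = (if j = 5 then 0 else j + 1) \<longleftrightarrow> j = (if i = 0 then 5 else i - 1)"
    using True by auto
  then have "i = (j + 1) mod 6 \<longleftrightarrow> j = (i + 5) mod 6"
    using True by (simp only: succ pred)
  then show ?thesis
    using True by (simp add: cycle_graph_def del: One_nat_def)
next
  case False
  then show ?thesis
    by (auto simp: cycle_graph_def)
qed

context graph
begin

text \<open>The isomorphism carries each neighbourhood onto two distinct residues modulo 6. This
  supplies what \<open>cycle_enumE\<close> needs to number the graph from any chosen vertex.\<close>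

lemma digraph_iso_C6_degree:
  assumes "digraph_iso G (with_proj (cycle_graph 6))"
  shows "card (verts G) = 6" and "x \<in> verts G \<Longrightarrow> card (nbhd G x) = 2"
proof -
  have verts: "pverts (cycle_graph 6) = {0..<6}"
    by (simp add: cycle_graph_def)
  have "parcs (cycle_graph 6) \<subseteq> pverts (cycle_graph 6) \<times> pverts (cycle_graph 6)"
    by (auto simp: cycle_graph_def)
  then obtain \<phi> where bij: "bij_betw \<phi> (verts G) {0..<6}"
    and adj: "\<And>u v. u \<in> verts G \<Longrightarrow> v \<in> verts G \<Longrightarrow>
      u \<rightarrow> v \<longleftrightarrow> (\<phi> u, \<phi> v) \<in> parcs (cycle_graph 6)"
    using assms by (auto simp: digraph_iso_with_proj_iff verts)
  then show "card (verts G) = 6"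
    using bij_betw_same_card[OF bij] by simp
  assume x: "x \<in> verts G"
  then have i: "\<phi> x < 6"
    using bij by (auto simp: bij_betw_def)
  have "\<phi> ` nbhd G x = {(\<phi> x + 1) mod 6, (\<phi> x + 5) mod 6}"
  proof (intro set_eqI iffI)
    fix j assume "j \<in> {(\<phi> x + 1) mod 6, (\<phi> x + 5) mod 6}"
    then have j: "(\<phi> x, j) \<in> parcs (cycle_graph 6)" and "j < 6"
      using i by (auto simp: parcs_cycle_graph_6)
    then obtain y where "y \<in> verts G" "j = \<phi> y"
      using bij by (auto simp: bij_betw_def) (metis (no_types) atLeast0LessThan imageE lessThan_iff)
    then show "j \<in> \<phi> ` nbhd G x"
      using adj[OF x, of y] j by (auto simp: nbhd_def)
  next
    fix j assume "j \<in> \<phi> ` nbhd G x"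
    then obtain y where "y \<in> nbhd G x" "j = \<phi> y"
      by blast
    moreover from this have "y \<in> verts G"
      using nbhd_subset by blast
    ultimately show "j \<in> {(\<phi> x + 1) mod 6, (\<phi> x + 5) mod 6}"
      using adj[OF x, of y] by (simp add: nbhd_def parcs_cycle_graph_6)
  qed
  moreover have "(\<phi> x + 1) mod 6 \<noteq> (\<phi> x + 5) mod 6"
    by presburger
  moreover have "inj_on \<phi> (nbhd G x)"
    using bij_betw_imp_inj_on[OF bij] nbhd_subset by (rule inj_on_subset)
  ultimately show "card (nbhd G x) = 2"
    using card_image[of \<phi> "nbhd G x"] by simp
qed

end

section \<open>The game on cycles\<close>

context cycle_enum
begin

lemma card_verts: "card (verts G) = n"
  using card_image[OF inj] verts by simp

lemma f_eq_iff: "i < n \<Longrightarrow> j < n \<Longrightarrow> f i = f j \<longleftrightarrow> i = j"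
  using inj by (auto simp: inj_on_def)

lemma f_in_image_iff: "i < n \<Longrightarrow> b \<le> n \<Longrightarrow> f i \<in> f ` {a..<b} \<longleftrightarrow> i \<in> {a..<b}"
  using inj by (intro inj_on_image_mem_iff) auto

lemma nbhd_f: "0 < k \<Longrightarrow> nbhd G (f k) = {f (k - 1), f (k + 1)}"
  using nbhd_Suc[of "k - 1"] by simp

lemma adj_f_Suc: "f k \<rightarrow> f (Suc k)" "f (Suc k) \<rightarrow> f k"
  using nbhd_Suc[of k] adj_sym by (auto simp: nbhd_def)

lemma live_initial: "live G {} = f ` {0..<n}"
proof -
  have "\<exists>w \<in> verts G. v \<rightarrow> w" if "v \<in> verts G" for v
    using that adj_f_Suc adj_in_verts(2) unfolding verts[symmetric] by blast
  then show ?thesis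
    by (auto simp: live_def verts atLeast0LessThan)
qed

text \<open>Positions on a cycle are tracked as index intervals. A remaining interval of length at
  least two is wholly live, because each of its vertices keeps a neighbour inside: the next one, or
  the previous one at the right end.\<close>

lemma live_insert_segment:
  assumes live: "live G X = f ` {a..<b}" and "b \<le> n" and "a \<le> a'" "b' \<le> b" "a' + 2 \<le> b'"
    and dom: "\<And>k. k \<in> {a..<b} \<Longrightarrow> f k \<in> insert x (nbhd G x) \<longleftrightarrow> k \<notin> {a'..<b'}"
  shows "live G (insert x X) = f ` {a'..<b'}"
proof (intro set_eqI iffI)
  fix v assume "v \<in> live G (insert x X)"
  then have "v \<in> f ` {a..<b}" "v \<notin> insert x (nbhd G x)"
    by (simp_all add: live_insert live)
  then show "v \<in> f ` {a'..<b'}"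
    using dom by blast
next
  fix v assume "v \<in> f ` {a'..<b'}"
  then obtain k where k: "k \<in> {a'..<b'}" "v = f k"
    by blast
  obtain l where "l \<in> {a'..<b'}" "f k \<rightarrow> f l"
  proof (cases "Suc k < b'")
    case True
    then show ?thesis
      using that[of "Suc k"] k adj_f_Suc by simp
  next
    case False
    then have "k - 1 \<in> {a'..<b'}" "k = Suc (k - 1)"
      using k(1) \<open>a' + 2 \<le> b'\<close> by auto
    then show ?thesis
      using that[of "k - 1"] adj_f_Suc(2)[of "k - 1"] by simp
  qed
  moreover have "f j \<in> live G X \<and> f j \<notin> insert x (nbhd G x)" if "j \<in> {a'..<b'}" for j
    using dom[of j] that \<open>a \<le> a'\<close> \<open>b' \<le> b\<close> by (simp add: live)
  ultimately show "v \<in> live G (insert x X)"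
    using k unfolding live_insert by blast
qed

text \<open>Opening at index 1 dominates the initial block 0, 1, 2, so the survivors form one
  interval that does not wrap around.\<close>

lemma live_first:
  assumes "5 \<le> n"
  shows "live G {f (Suc 0)} = f ` {3..<n}"
  using assms nbhd_Suc[of 0]
  by (intro live_insert_segment[OF live_initial]) (auto simp: f_eq_iff)

text \<open>The move \<open>f 1\<close> dominates everything but \<open>f 3\<close>, which then has
  only dominated neighbours. So all four vertices die at once.\<close>

lemma C4_less:
  assumes "n = 4"
  shows "2 * moves_left G Dominator {} < n"
proof -
  have "v \<notin> live G {f (Suc 0)}" for v
  proof
    assume v: "v \<in> live G {f (Suc 0)}"
    have out: "f k \<notin> live G {f (Suc 0)}" if "k \<in> {0, 1, 2}" for k
      using that nbhd_Suc[of 0] by (auto simp: live_insert numeral_2_eq_2)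
    obtain k where k: "k < 4" "v = f k"
      using v live_subset[of "{f (Suc 0)}"] verts assms by auto
    have "k \<notin> {0, 1, 2}"
      using out v k(2) by blast
    then have "k \<noteq> 0 \<and> k \<noteq> 1 \<and> k \<noteq> 2"
      by simp
    then have "k = Suc 2"
      using k(1) by presburger
    then have "v = f (Suc 2)"
      using k(2) by simp
    moreover obtain w where w: "w \<in> live G {f (Suc 0)}" "v \<rightarrow> w"
      using live_has_live_neighbour[OF v] .
    ultimately have "w \<in> nbhd G (f (Suc 2))"
      by (simp add: nbhd_def)
    moreover have "f (Suc (Suc 2)) = f 0"
      using wrap assms by (simp add: eval_nat_numeral)
    ultimately have "w = f 2 \<or> w = f 0"
      unfolding nbhd_Suc by auto
    then show False
      using w(1) out[of 0] out[of 2] by auto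
  qed
  then have "live G {f (Suc 0)} = {}"
    by blast
  moreover have "f (Suc 0) \<in> live G {}"
    using n by (simp add: live_initial)
  moreover have "card (live G {}) = n"
    using card_verts by (simp add: live_initial verts atLeast0LessThan)
  ultimately show ?thesis
    using twice_moves_left_less[of "f 1" "{}"] live_playable assms by simp
qed

text \<open>The budget is \<open>n - 1\<close>, and the opening leaves \<open>n - 3\<close> live
  vertices. A live reply kills two more, five in total. Any other reply leaves a path of
  \<open>n - 4\<close> vertices, at least four, where \<open>twice_moves_left_less_leaf\<close>
  recovers the missing unit.\<close>

lemma C8_less:
  assumes n8: "8 \<le> n"
  shows "2 * moves_left G Dominator {} < n"
proof -
  have live1: "live G {f (Suc 0)} = f ` {3..<n}"
    using live_first n8 by simp
  have card_seg: "card (f ` {a..<b}) = b - a" if "b \<le> n" for a b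
  proof -
    have "inj_on f {a..<b}"
      using inj by (rule inj_on_subset) (use that in auto)
    then show ?thesis
      by (simp add: card_image)
  qed
  have "2 * moves_left G Dominator {} \<le> n - 1"
  proof (rule moves_left_round[of "f (Suc 0)"])
    show "f (Suc 0) \<in> playable G {}"
      using n8 by (intro live_playable) (simp add: live_initial)
    fix y assume "y \<in> playable G {f (Suc 0)}"
    then obtain z where y: "y \<in> verts G" and z: "z \<in> live G {f (Suc 0)}" "y = z \<or> y \<rightarrow> z"
      by (auto simp: playable_iff_live)
    show "2 * moves_left G Dominator (insert y {f (Suc 0)}) + 4 \<le> n - 1"
    proof (cases "y \<in> live G {f (Suc 0)}")
      case True
      then obtain w where "w \<in> nbhd G y \<inter> live G {f (Suc 0)}"
        using live_has_live_neighbour[OF True] by (auto simp: nbhd_def)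
      then have "card (nbhd G y \<inter> live G {f (Suc 0)}) \<noteq> 0"
        by (auto simp: card_eq_0_iff)
      moreover have "card (live G {f (Suc 0)}) = n - 3"
        unfolding live1 by (simp add: card_seg)
      ultimately have "card (live G (insert y {f (Suc 0)})) + 2 \<le> n - 3"
        using card_live_live[OF True] by linarith
      then show ?thesis
        using twice_moves_left_le[of "insert y {f (Suc 0)}"] n8 by linarith
    next
      case False
      obtain k where k: "k < n" "y = f k"
        using y verts by auto
      then have "k < 3"
        using False by (simp add: live1 f_in_image_iff)
      \<comment> \<open>This vertex is already selected, and everything it dominates is
        dead.\<close>
      moreover have "k \<noteq> 1"
      proof
        assume "k = 1"
        then have "z \<in> nbhd G (f (Suc 0))"
          using z False k(2) by (auto simp: nbhd_def)
        then have "z = f 0 \<or> z = f 2"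
          using nbhd_Suc[of 0] by (auto simp: numeral_2_eq_2)
        then show False
          using z(1) n8 unfolding live1 by (auto simp: f_eq_iff)
      qed
      ultimately have "k = 2 \<or> k = 0"
        by presburger
      then consider "y = f 2" | "y = f 0"
        using k(2) by blast
      \<comment> \<open>These replies cut off one end of the surviving path: \<open>f 2\<close>
        kills \<open>f 3\<close>, and \<open>f 0\<close> kills \<open>f (n - 1)\<close>. In both
        cases the new left end serves as the leaf.\<close>
      then have "2 * moves_left G Dominator (insert y {f (Suc 0)}) < n - 4"
      proof cases
        case 1
        have live2: "live G {f 2, f (Suc 0)} = f ` {4..<n}"
          using n8 nbhd_f[of 2] by (intro live_insert_segment[OF live1]) (auto simp: f_eq_iff)
        have "nbhd G (f 4) \<inter> live G {f 2, f (Suc 0)} = {f 5}"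
          using n8 nbhd_f[of 4] by (auto simp: live2 f_eq_iff)
        then show ?thesis
          using twice_moves_left_less_leaf[of "f 4" "{f 2, f (Suc 0)}" "f 5" "f 6" "f 7"]
            adj_f_Suc(1)[of 5] adj_f_Suc(1)[of 6] n8 card_seg[of n 4]
          by (simp add: 1 live2 f_eq_iff)
      next
        case 2
        have live2: "live G {f 0, f (Suc 0)} = f ` {3..<n - 1}"
          using n8 nbhd_0 by (intro live_insert_segment[OF live1]) (auto simp: f_eq_iff)
        have "nbhd G (f 3) \<inter> live G {f 0, f (Suc 0)} = {f 4}"
          using n8 nbhd_f[of 3] by (auto simp: live2 f_eq_iff)
        then show ?thesis
          using twice_moves_left_less_leaf[of "f 3" "{f 0, f (Suc 0)}" "f 4" "f 5" "f 6"]
            adj_f_Suc(1)[of 4] adj_f_Suc(1)[of 5] n8 card_seg[of "n - 1" 3]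
          by (simp add: 2 live2 f_eq_iff)
      qed
      then show ?thesis
        by linarith
    qed
  qed (use n8 in linarith)
  then show ?thesis
    using n8 by linarith
qed

lemma C6_iso:
  assumes n6: "n = 6"
  shows "digraph_iso G (with_proj (cycle_graph 6))"
proof -
  have nb: "nbhd G (f k) = {f ((k + 1) mod 6), f ((k + 5) mod 6)}" if "k < 6" for k
  proof -
    have "k = 0 \<or> 0 < k \<and> k < 5 \<or> k = 5"
      using that by linarith
    then consider "k = 0" | "0 < k" "k < 5" | "k = 5"
      by blast
    then show ?thesis
    proof cases
      case 1
      then show ?thesis
        using nbhd_0 n6 by simp
    next
      case 2
      then have "(k + 5) mod 6 = k - 1" "(k + 1) mod 6 = k + 1"
        by presburger+
      then show ?thesis
        using 2 nbhd_f[of k] by (simp add: insert_commute)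
    next
      case 3
      then show ?thesis
        using nbhd_f[of k] wrap n6 by (simp add: insert_commute)
    qed
  qed
  have bij: "bij_betw f {..<6} (verts G)"
    using inj verts n6 by (simp add: bij_betw_def)
  \<comment> \<open>The enumeration goes from indices to vertices, so the isomorphism onto the cycle
    is its inverse.\<close>
  define \<phi> where "\<phi> = the_inv_into {..<6} f"
  have "bij_betw \<phi> (verts G) {..<6}"
    unfolding \<phi>_def by (rule bij_betw_the_inv_into[OF bij])
  moreover have "f i \<rightarrow> f j \<longleftrightarrow> (\<phi> (f i), \<phi> (f j)) \<in> parcs (cycle_graph 6)"
    if "i < 6" "j < 6" for i j
  proof -
    have "f i \<rightarrow> f j \<longleftrightarrow> f j \<in> nbhd G (f i)"
      by (simp add: nbhd_def)
    also have "\<dots> \<longleftrightarrow> j \<in> {(i + 1) mod 6, (i + 5) mod 6}"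
      using that n6 by (simp add: nb f_eq_iff)
    also have "\<dots> \<longleftrightarrow> (i, j) \<in> parcs (cycle_graph 6)"
      using that by (simp add: parcs_cycle_graph_6)
    finally show ?thesis
      using that inj n6 by (simp add: \<phi>_def the_inv_into_f_f)
  qed
  ultimately show ?thesis
    using n6 unfolding verts[symmetric]
    by (subst digraph_iso_with_proj_iff)
      (auto simp: cycle_graph_def atLeast0LessThan verts[symmetric])
qed

text \<open>After \<open>f 0\<close> the path \<open>f 2\<close>, \<open>f 3\<close>,
  \<open>f 4\<close> is live. Staller answers with the dominated vertex \<open>f 1\<close>, which
  kills only the end \<open>f 2\<close>; the remaining edge forces a third move.\<close>

lemma C6_Staller:
  assumes n6: "n = 6"
  shows "2 \<le> moves_left G Staller {f 0}"
proof -
  have live0: "live G {f 0} = f ` {2..<5}"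
    using n6 nbhd_0 by (intro live_insert_segment[OF live_initial]) (auto simp: f_eq_iff)
  have "live G {f 1, f 0} = f ` {3..<5}"
    using n6 nbhd_f[of 1] by (intro live_insert_segment[OF live0]) (auto simp: f_eq_iff)
  then have "f 3 \<in> playable G {f 1, f 0}"
    by (intro live_playable) simp
  then have "1 + 0 \<le> moves_left G Dominator {f 1, f 0}"
    by (intro moves_left_Dominator_ge) auto
  moreover have "f 1 \<in> playable G {f 0}"
    using adj_f_Suc(1)[of 1] adj_in_verts(1) live0
    by (auto simp: playable_iff_live numeral_2_eq_2)
  ultimately show ?thesis
    using moves_left_Staller_ge[of "f 1" "{f 0}"] by linarith
qed

end

section \<open>The graphs attaining equality\<close>

context graph
begin

lemma complete_digraph_2I:
  assumes conn: "Digraph_Component.connected G" and card2: "card (verts G) = 2"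
  shows "complete_digraph 2 G"
proof -
  have "u \<rightarrow> v" if "u \<in> verts G" "v \<in> verts G" "u \<noteq> v" for u v
  proof -
    have "u \<in> live G {}"
      using live_empty[OF conn] card2 that(1) by simp
    then obtain w where w: "w \<in> live G {}" "u \<rightarrow> w"
      by (rule live_has_live_neighbour)
    have "{u, v} = verts G"
      using that card2 by (intro card_seteq) auto
    moreover have "w \<in> verts G"
      using w(1) live_subset by blast
    ultimately have "w = u \<or> w = v"
      by auto
    then show ?thesis
      using w(2) by auto
  qed
  moreover have "u \<in> verts G \<and> v \<in> verts G \<and> u \<noteq> v" if "u \<rightarrow> v" for u v
    using that adj_in_verts adj_irrefl by blast
  ultimately have "arcs_ends G = {(u, v). (u, v) \<in> verts G \<times> verts G \<and> u \<noteq> v}"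
    by blast
  then show ?thesis
    using card2 graph_axioms by (simp add: complete_digraph_def)
qed

lemma equality_cases:
  assumes conn: "Digraph_Component.connected G"
    and eq: "2 * moves_left G Dominator {} = card (verts G)"
  shows "complete_digraph 2 G \<or> digraph_iso G (with_proj (cycle_graph 6))"
proof -
  have ne: "verts G \<noteq> {}"
    using conn by (simp add: Digraph_Component.connected_def strongly_connected_def)
  then have "card (verts G) \<noteq> 0"
    by simp
  \<comment> \<open>Equality makes the order even; it is also nonzero. The same parity excludes 3, 5
    and 7 below.\<close>
  then have two: "2 \<le> card (verts G)"
    using eq by presburger
  have not_less: "\<not> 2 * moves_left G Dominator {} < card (verts G)"
    using eq by simp
  have live: "live G {} = verts G"
    using live_empty[OF conn two] .
  show ?thesis
  proof (cases "card (verts G) = 2")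
    case True
    then show ?thesis
      using complete_digraph_2I[OF conn] by simp
  next
    case False
    then have four: "4 \<le> card (verts G)"
      using eq two by presburger
    \<comment> \<open>Equality contradicts each strictness criterion in turn: no vertex of degree
      three or more, then no leaf, so the graph is 2-regular.\<close>
    have le2: "card (nbhd G x) \<le> 2" if "x \<in> verts G" for x
      using less_of_degree_ge_3[OF live that] not_less by linarith
    have deg: "card (nbhd G x) = 2" if x: "x \<in> verts G" for x
    proof -
      obtain w where "w \<in> nbhd G x"
        using live_has_live_neighbour[of x "{}"] live x by (auto simp: nbhd_def)
      then have "card (nbhd G x) \<noteq> 0"
        by auto
      moreover have "card (nbhd G x) \<noteq> 1"
        using less_of_leaf[OF conn four le2 x] not_less by blast
      ultimately show ?thesis
        using le2[OF x] by linarith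
    qed
    obtain v where "v \<in> verts G"
      using ne by blast
    then obtain f where "cycle_enum G f (card (verts G))"
      using cycle_enumE[OF conn deg] by metis
    then interpret cycle_enum G f "card (verts G)" .
    have "card (verts G) = 4 \<or> card (verts G) = 6 \<or> 8 \<le> card (verts G)"
      using eq four by presburger
    then show ?thesis
      using C4_less C6_iso C8_less not_less by blast
  qed
qed

text \<open>Any opening of Dominator can be numbered 0 in a suitable enumeration of the cycle, so
  the single reply of \<open>C6_Staller\<close> answers them all.\<close>

lemma C6_lower_bound:
  assumes conn: "Digraph_Component.connected G"
    and iso: "digraph_iso G (with_proj (cycle_graph 6))"
  shows "3 \<le> moves_left G Dominator {}"
proof -
  note card6 = digraph_iso_C6_degree(1)[OF iso]
  have "2 \<le> moves_left G Staller {x}" if x: "x \<in> playable G {}" for x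
  proof -
    have "x \<in> verts G"
      using x by (simp add: playable_iff_live)
    then obtain f where f: "cycle_enum G f (card (verts G))" "f 0 = x"
      using cycle_enumE[OF conn digraph_iso_C6_degree(2)[OF iso]] by metis
    then show ?thesis
      using cycle_enum.C6_Staller[OF f(1) card6] by simp
  qed
  moreover have "live G {} \<noteq> {}"
    using live_empty[OF conn] card6 by auto
  then have "playable G {} \<noteq> {}"
    using live_playable by blast
  ultimately have "1 + 2 \<le> moves_left G Dominator {}"
    by (intro moves_left_Dominator_ge) auto
  then show ?thesis
    by simp
qed

end

theorem theorem3p1:
  fixes G :: "('a, 'b) pre_digraph" and n :: nat
  assumes "graph G" and "Digraph_Component.connected G" and "card (verts G) = n"
  shows "real (\<iota>\<^sub>g G) \<le> 1 / 2 * real n \<and>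
    (real (\<iota>\<^sub>g G) = 1 / 2 * real n \<longleftrightarrow>
      complete_digraph 2 G \<or> digraph_iso G (with_proj (cycle_graph 6)))"
proof -
  interpret graph G
    by fact
  note conn = assms(2)
  have "card (live G {}) \<le> n"
    using card_mono[OF finite_verts live_subset] assms(3) by blast
  then have le: "2 * \<iota>\<^sub>g G \<le> n"
    using twice_moves_left_le[of "{}"] by (simp add: game_isolation_number_def)
  \<comment> \<open>The equality case is settled over the natural numbers, with the denominator
    cleared.\<close>
  have "2 * \<iota>\<^sub>g G = n \<longleftrightarrow>
    complete_digraph 2 G \<or> digraph_iso G (with_proj (cycle_graph 6))"
  proof
    assume "2 * \<iota>\<^sub>g G = n"
    then show "complete_digraph 2 G \<or> digraph_iso G (with_proj (cycle_graph 6))"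
      using equality_cases[OF conn] assms(3) by (simp add: game_isolation_number_def)
  next
    assume "complete_digraph 2 G \<or> digraph_iso G (with_proj (cycle_graph 6))"
    then show "2 * \<iota>\<^sub>g G = n"
    proof
      assume "complete_digraph 2 G"
      then have n2: "n = 2"
        using assms(3) by (simp add: complete_digraph_def)
      then have "live G {} = verts G" "verts G \<noteq> {}"
        using live_empty[OF conn] assms(3) by auto
      then have "playable G {} \<noteq> {}"
        using live_playable by blast
      \<comment> \<open>A playable vertex forces one move, which meets the upper bound for order
        two.\<close>
      then have "1 + 0 \<le> \<iota>\<^sub>g G"
        unfolding game_isolation_number_def by (intro moves_left_Dominator_ge) auto
      then show ?thesis
        using le n2 by linarith
    next
      assume iso: "digraph_iso G (with_proj (cycle_graph 6))"
      then have "n = 6"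
        using digraph_iso_C6_degree(1) assms(3) by simp
      then show ?thesis
        using C6_lower_bound[OF conn iso] le by (simp add: game_isolation_number_def)
    qed
  qed
  moreover have "real (\<iota>\<^sub>g G) = 1 / 2 * real n \<longleftrightarrow> 2 * \<iota>\<^sub>g G = n"
    by linarith
  moreover have "real (\<iota>\<^sub>g G) \<le> 1 / 2 * real n"
    using le by linarith
  ultimately show ?thesis
    by blast
qed

end
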